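(* Let $\{x(t)\}_{t\ge 1}$ be the iterates of the stochastic mirror descent algorithm $$x(t+1)=\operatorname*{arg\,min}_{x\in\mathbb{X}}\Big\{\langle \tilde g(t),x-x(t)\rangle+\frac{1}{\alpha(t)}\mathbb{D}_R(x,x(t))\Big\},\qquad t\ge 1,$$ for the problem $\min_{x\in\mathbb{X}}f(x)$, under Assumptions A1, A2, A3 of the context, and let $z(t)=\big(\sum_{k=1}^t\alpha(k)\big)^{-1}\sum_{j=1}^t\alpha(j)x(j)$. Then $$f(z(t))-f^\ast=\mathcal{O}\Big(\frac{1}{\sum_{j=1}^t\alpha(j)}\Big)\quad\text{almost surely},$$ that is, $\limsup_{t\to\infty}\big(\sum_{j=1}^t\alpha(j)\big)\,\big(f(z(t))-f^\ast\big)<\infty$ almost surely.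
   Context: Setting. $\|\cdot\|$ is an arbitrary norm on $\mathbb{R}^n$, $\|x\|_\ast=\sup\{\langle x,y\rangle:\|y\|\le 1\}$ its dual norm. $\mathbb{X}\subseteq\mathbb{R}^n$ is nonempty, convex and compact. $f:\mathbb{R}^n\to\mathbb{R}$ is convex (and continuous), $f^\ast=\min_{x\in\mathbb{X}}f(x)$. Bregman divergence. $R$ is $\sigma_R$-strongly convex with respect to $\|\cdot\|$ ($\sigma_R>0$) and differentiable on an open set containing $\mathbb{X}$, and $\mathbb{D}_R(x,y)=R(x)-R(y)-\langle\nabla R(y),x-y\rangle$ for $x,y\in\mathbb{X}$. Algorithm. $x(1)\in\mathbb{X}$ is the initial point, $\alpha(t)>0$ are deterministic step-sizes, and $\tilde g(t)$ is a random vector (a noisy subgradient of $f$ at $x(t)$). $\mathcal{F}_t=\sigma(x(1),\dots,x(t))$. Assumption A1. $\mathbb{E}[\tilde g(t)\mid\mathcal{F}_t]=g(t)+b(t)$ a.s., where $g(t)\in\partial f(x(t))$ is a subgradient of $f$ at $x(t)$ and $b(t)$ is an $\mathcal{F}_t$-measurable random vector (the bias); and $\mathbb{E}[\|\tilde g(t)\|_\ast^2\mid\mathcal{F}_t]\le\nu^2$ a.s. for all $t$, for a constant $\nu$. Assumption A2. $\sum_{t\ge1}\alpha(t)=\infty$ and $\sum_{t\ge1}\alpha(t)^2<\infty$. Assumption A3. With $B(t)=\|b(t)\|_\ast$, $\sum_{t\ge1}\alpha(t)B(t)<\infty$ almost surely. Convention. For random variables $X_i$ and positive reals $a_i$, $X_i=\mathcal{O}(a_i)$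 a.s. means $\limsup_{i\to\infty}|X_i|/a_i<\infty$ a.s. *)

theory Defs
  imports "HOL-Probability.Probability"
begin

definition is_norm :: "('v::real_vector \<Rightarrow> real) \<Rightarrow> bool" where
  "is_norm N \<longleftrightarrow>
     (\<forall>x. 0 \<le> N x) \<and> (\<forall>x. N x = 0 \<longleftrightarrow> x = 0) \<and>
     (\<forall>c x. N (c *\<^sub>R x) = \<bar>c\<bar> * N x) \<and> (\<forall>x y. N (x + y) \<le> N x + N y)"

definition dual_norm :: "('v::real_inner \<Rightarrow> real) \<Rightarrow> 'v \<Rightarrow> real" where
  "dual_norm N x = (SUP y \<in> {y. N y \<le> 1}. x \<bullet> y)"

text \<open>Same shape as \<open>convex_on\<close>, with the quadratic gap measured in the norm \<open>N\<close>.\<close>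

definition strongly_convex_on ::
  "'v::real_vector set \<Rightarrow> ('v \<Rightarrow> real) \<Rightarrow> real \<Rightarrow> ('v \<Rightarrow> real) \<Rightarrow> bool" where
  "strongly_convex_on S N \<sigma> R \<longleftrightarrow>
     convex S \<and>
     (\<forall>x\<in>S. \<forall>y\<in>S. \<forall>u\<ge>0. \<forall>v\<ge>0. u + v = 1 \<longrightarrow>
        R (u *\<^sub>R x + v *\<^sub>R y) \<le> u * R x + v * R y - \<sigma> / 2 * u * v * (N (x - y))\<^sup>2)"

text \<open>Meaningful only at points where \<open>R\<close> is differentiable, where it is unique.\<close>

definition gradient :: "('v::real_inner \<Rightarrow> real) \<Rightarrow> 'v \<Rightarrow> 'v" where
  "gradient R y = (THE D. GDERIV R y :> D)"

definition bregman :: "('v::real_inner \<Rightarrow> real) \<Rightarrow> 'v \<Rightarrow> 'v \<Rightarrow> real" where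
  "bregman R x y = R x - R y - gradient R y \<bullet> (x - y)"

definition subdifferential :: "('v::real_inner \<Rightarrow> real) \<Rightarrow> 'v \<Rightarrow> 'v set" where
  "subdifferential f x = {g. \<forall>y. f y \<ge> f x + g \<bullet> (y - x)}"

text \<open>The sigma-algebra generated by the random variables \<open>x 1, \<dots>, x t\<close>.\<close>

definition history ::
  "'w measure \<Rightarrow> (nat \<Rightarrow> 'w \<Rightarrow> 'v::topological_space) \<Rightarrow> nat \<Rightarrow> 'w measure" where
  "history M x t =
     sigma (space M) {x j -` A \<inter> space M | j A. j \<in> {1..t} \<and> A \<in> sets borel}"

definition vec_cond_exp ::
  "'w measure \<Rightarrow> 'w measure \<Rightarrow> ('w \<Rightarrow> real ^ 'n) \<Rightarrow> 'w \<Rightarrow> real ^ 'n" where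
  "vec_cond_exp M F Y \<omega> = (\<chi> i. real_cond_exp M F (\<lambda>\<omega>'. Y \<omega>' $ i) \<omega>)"

definition bigo_as :: "'w measure \<Rightarrow> (nat \<Rightarrow> 'w \<Rightarrow> real) \<Rightarrow> (nat \<Rightarrow> real) \<Rightarrow> bool" where
  "bigo_as M Y a \<longleftrightarrow> (AE \<omega> in M. limsup (\<lambda>i. ereal (\<bar>Y i \<omega>\<bar> / a i)) < \<infinity>)"

text \<open>Averages of \<open>x 1, x 2, \<dots>\<close>; index \<open>0\<close> is never used.\<close>

definition weighted_average :: "(nat \<Rightarrow> real) \<Rightarrow> (nat \<Rightarrow> 'v::real_vector) \<Rightarrow> nat \<Rightarrow> 'v" where
  "weighted_average \<alpha> x t = inverse (\<Sum>k=1..t. \<alpha> k) *\<^sub>R (\<Sum>j=1..t. \<alpha> j *\<^sub>R x j)"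

end

theory Submission
  imports Defs
begin

text \<open>
  Let \<open>p\<close> minimise \<open>f\<close> on \<open>X\<close> and let \<open>V t\<close> be the Bregman divergence from \<open>p\<close> to the \<open>t\<close>-th iterate.
  First-order optimality of the mirror step, combined with strong convexity of \<open>R\<close> and the
  inequality \<open>a b \<le> a\<^sup>2 / (2 \<sigma>) + \<sigma> b\<^sup>2 / 2\<close>, gives for every single outcome
  (\<open>mirror_step_bregman_decrease\<close>) that \<open>V\<close> drops in step \<open>t\<close> by at least
  \<open>Y t = \<alpha> t (gt t \<bullet> (x t - p)) - (\<alpha> t)\<^sup>2 \<parallel>gt t\<parallel>\<^sup>2 / (2 \<sigma>)\<close>, the norm being the dual one.
  Conditioning on the history and using the subgradient inequality, \<open>Y t\<close> has conditional mean at
  least \<open>h t - \<beta> t - e t\<close>, where \<open>h t = \<alpha> t (f (x t) - f p)\<close> is nonnegative, \<open>\<beta> t\<close> is a multiple of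
  \<open>\<alpha> t \<parallel>b t\<parallel>\<close> and \<open>e t\<close> a multiple of \<open>(\<alpha> t)\<^sup>2\<close>. Since \<open>V\<close> stays nonnegative and \<open>\<beta>\<close>, \<open>e\<close> are almost surely
  summable, so is \<open>h\<close> (\<open>summable_if_conditional_drift\<close>, in the spirit of Robbins and Siegmund).
  By Jensen's inequality the error of the averaged iterate times the total step size is at most
  the sum of \<open>h\<close>, which is the claim.

  Two points decide the form of the argument. The history records the iterates only, and an iterate on
  the boundary of \<open>X\<close> need not determine the noisy gradient that led to it; hence the sums of the
  gradient noise need not be adapted to the history, and martingale bounds cannot be applied to them.
  Therefore the drop of \<open>V\<close> as a whole is integrated against events of the history.
  Moreover \<open>R\<close> is convex only on \<open>X\<close>, so its gradient may be unbounded near the boundary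
  and \<open>V\<close> at the first iterate need not be integrable; the drift lemma therefore
  works on events of the history on which the initial value is bounded.
\<close>

section \<open>Arbitrary norms on a Euclidean space\<close>

lemma is_norm_convex_on:
  assumes "is_norm N"
  shows "convex_on UNIV N"
proof (rule convex_onI)
  fix t :: real and x y
  assume t: "0 < t" "t < 1"
  have "N ((1 - t) *\<^sub>R x + t *\<^sub>R y) \<le> N ((1 - t) *\<^sub>R x) + N (t *\<^sub>R y)"
    using assms unfolding is_norm_def by blast
  also have "\<dots> = (1 - t) * N x + t * N y"
    using assms t unfolding is_norm_def by simp
  finally show "N ((1 - t) *\<^sub>R x + t *\<^sub>R y) \<le> (1 - t) * N x + t * N y" .
qed simp

text \<open>By homogeneity it is enough to compare the two norms on the Euclidean unit sphere, where \<open>N\<close>,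
  continuous because convex, attains a positive minimum and a maximum.\<close>

lemma is_norm_equivalent_norm:
  fixes N :: "'v::euclidean_space \<Rightarrow> real"
  assumes "is_norm N"
  obtains c C where "c > 0" "\<And>y. c * norm y \<le> N y" "C > 0" "\<And>y. N y \<le> C * norm y"
proof -
  have cont: "continuous_on (sphere (0::'v) 1) N"
    by (rule continuous_on_subset[OF convex_on_continuous[OF open_UNIV is_norm_convex_on[OF assms]]])
       simp
  have ne: "sphere (0::'v) 1 \<noteq> {}"
    by (simp add: sphere_eq_empty)
  obtain l where l: "l \<in> sphere (0::'v) 1" "\<And>y. y \<in> sphere 0 1 \<Longrightarrow> N l \<le> N y"
    using continuous_attains_inf[OF compact_sphere ne cont] by blast
  obtain u where u: "u \<in> sphere (0::'v) 1" "\<And>y. y \<in> sphere 0 1 \<Longrightarrow> N y \<le> N u"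
    using continuous_attains_sup[OF compact_sphere ne cont] by blast
  have pos: "N y > 0" if "y \<in> sphere 0 1" for y
  proof -
    have "y \<noteq> 0" using that by auto
    then show ?thesis using assms unfolding is_norm_def by (metis order_le_less)
  qed
  have scale: "N y = norm y * N (y /\<^sub>R norm y)" if "y \<noteq> 0" for y
  proof -
    have "N (y /\<^sub>R norm y) = \<bar>inverse (norm y)\<bar> * N y"
      using assms unfolding is_norm_def by blast
    then show ?thesis using that by simp
  qed
  have zero: "N 0 = 0"
    using assms unfolding is_norm_def by blast
  show thesis
  proof
    show "N l > 0" "N u > 0" using pos l(1) u(1) by auto
    show "N l * norm y \<le> N y" for y
      using scale[of y] l(2)[of "y /\<^sub>R norm y"] zero
      by (cases "y = 0") (auto simp: mult.commute intro: mult_left_mono)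
    show "N y \<le> N u * norm y" for y
      using scale[of y] u(2)[of "y /\<^sub>R norm y"] zero
      by (cases "y = 0") (auto simp: mult.commute intro: mult_left_mono)
  qed
qed

text \<open>The unit ball of \<open>N\<close> is bounded in the Euclidean norm. Without this the supremum that defines
  \<open>dual_norm\<close> would be an unspecified value.\<close>

lemma dual_norm_bdd_above:
  fixes N :: "'v::euclidean_space \<Rightarrow> real"
  assumes "is_norm N"
  shows "bdd_above ((\<lambda>y. x \<bullet> y) ` {y. N y \<le> 1})"
proof -
  obtain c where c: "c > 0" "\<And>y. c * norm y \<le> N y"
    using is_norm_equivalent_norm[OF assms] by metis
  have "x \<bullet> y \<le> norm x * (1 / c)" if "N y \<le> 1" for y
  proof -
    have "norm y \<le> 1 / c"
      using c(2)[of y] c(1) that by (simp add: field_simps)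
    then show ?thesis
      using norm_cauchy_schwarz[of x y] mult_left_mono[of "norm y" "1 / c" "norm x"] by simp
  qed
  then show ?thesis by (intro bdd_aboveI2) auto
qed

lemma dual_norm_upper:
  fixes N :: "'v::euclidean_space \<Rightarrow> real"
  assumes "is_norm N" "N y \<le> 1"
  shows "x \<bullet> y \<le> dual_norm N x"
  unfolding dual_norm_def
  by (rule cSUP_upper2[OF dual_norm_bdd_above[OF assms(1)], of y]) (use assms in auto)

lemma dual_norm_nonneg:
  fixes N :: "'v::euclidean_space \<Rightarrow> real"
  assumes "is_norm N"
  shows "0 \<le> dual_norm N x"
proof -
  have "N 0 = 0" using assms unfolding is_norm_def by blast
  then show ?thesis using dual_norm_upper[OF assms, of 0 x] by simp
qed

lemma inner_le_dual_norm:
  fixes N :: "'v::euclidean_space \<Rightarrow> real"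
  assumes "is_norm N"
  shows "x \<bullet> y \<le> dual_norm N x * N y"
proof (cases "y = 0")
  case True
  moreover have "N 0 = 0" using assms unfolding is_norm_def by blast
  ultimately show ?thesis by simp
next
  case False
  then have pos: "N y > 0" using assms unfolding is_norm_def by (metis order_le_less)
  have "N (y /\<^sub>R N y) = \<bar>inverse (N y)\<bar> * N y"
    using assms unfolding is_norm_def by blast
  then have "x \<bullet> (y /\<^sub>R N y) \<le> dual_norm N x"
    using pos by (intro dual_norm_upper[OF assms]) simp
  then show ?thesis using pos by (simp add: field_simps)
qed

text \<open>A supremum of linear functions is convex, and finite convex functions on the whole space are
  continuous. Continuity is what makes the dual norm of a random vector measurable.\<close>

lemma continuous_on_dual_norm:
  fixes N :: "'v::euclidean_space \<Rightarrow> real"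
  assumes "is_norm N"
  shows "continuous_on UNIV (dual_norm N)"
proof (rule convex_on_continuous[OF open_UNIV], rule convex_onI)
  fix t :: real and x y :: 'v
  assume t: "0 < t" "t < 1"
  have ne: "{y. N y \<le> 1} \<noteq> {}"
    using assms unfolding is_norm_def by (metis (mono_tags) empty_Collect_eq zero_le_one)
  have "((1 - t) *\<^sub>R x + t *\<^sub>R y) \<bullet> z \<le> (1 - t) * dual_norm N x + t * dual_norm N y"
    if "N z \<le> 1" for z
    using dual_norm_upper[OF assms that, of x] dual_norm_upper[OF assms that, of y] t
    by (auto simp: inner_add_left intro!: add_mono mult_left_mono)
  then show "dual_norm N ((1 - t) *\<^sub>R x + t *\<^sub>R y) \<le> (1 - t) * dual_norm N x + t * dual_norm N y"
    unfolding dual_norm_def[of N "(1 - t) *\<^sub>R x + t *\<^sub>R y"] by (intro cSUP_least[OF ne]) auto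
qed simp

text \<open>Testing \<open>x\<close> against itself in the duality inequality bounds its Euclidean norm. This turns the second
  moment bound in the dual norm into componentwise integrability.\<close>

lemma norm_le_dual_norm:
  fixes N :: "'v::euclidean_space \<Rightarrow> real"
  assumes "is_norm N"
  obtains C where "C > 0" "\<And>x. norm x \<le> C * dual_norm N x"
proof -
  obtain C where C: "C > 0" "\<And>y. N y \<le> C * norm y"
    using is_norm_equivalent_norm[OF assms] by metis
  have "norm x \<le> C * dual_norm N x" for x
  proof (cases "x = 0")
    case True
    then show ?thesis using C dual_norm_nonneg[OF assms, of x] by simp
  next
    case False
    have "norm x * norm x = x \<bullet> x" by (simp add: dot_square_norm power2_eq_square)
    also have "\<dots> \<le> dual_norm N x * N x" by (rule inner_le_dual_norm[OF assms])
    also have "\<dots> \<le> dual_norm N x * (C * norm x)"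
      by (intro mult_left_mono C dual_norm_nonneg assms)
    finally have "norm x * norm x \<le> (C * dual_norm N x) * norm x" by (simp add: ac_simps)
    then show ?thesis using False by simp
  qed
  then show thesis using C that by blast
qed

section \<open>Bregman divergences and the mirror step\<close>

text \<open>A differentiable function on a Euclidean space has a gradient by Riesz representation, so \<open>gradient\<close>
  denotes it and yields the directional derivatives. They are taken along the steps \<open>1 / (k + 1)\<close>
  because one sequence of difference quotients serves three purposes: inequalities between quotients pass to
  the limit, quotients taken towards points of a convex set stay inside it, and a pointwise limit
  of a sequence of measurable functions is measurable.\<close>

lemma gradient_quotients_tendsto:
  fixes R :: "'v::euclidean_space \<Rightarrow> real"
  assumes "R differentiable (at y)"
  shows "(\<lambda>k. (R (y + inverse (real (Suc k)) *\<^sub>R h) - R y) / inverse (real (Suc k)))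
           \<longlonglongrightarrow> gradient R y \<bullet> h"
proof -
  obtain L where L: "(R has_derivative L) (at y)"
    using assms unfolding differentiable_def by blast
  have lin: "linear L" using L by (rule has_derivative_linear)
  have L_eq: "L = (\<lambda>h. h \<bullet> adjoint L 1)"
    using adjoint_works[OF lin, of _ 1] by auto
  have G: "GDERIV R y :> adjoint L 1"
    unfolding gderiv_def using L L_eq by simp
  have "gradient R y = adjoint L 1"
    unfolding gradient_def
  proof (rule the_equality)
    fix D assume "GDERIV R y :> D"
    then have "(\<lambda>h. h \<bullet> D) = (\<lambda>h. h \<bullet> adjoint L 1)"
      using G has_derivative_unique unfolding gderiv_def by blast
    then show "D = adjoint L 1" by (metis vector_eq_ldot)
  qed (rule G)
  then have Lh: "L h = gradient R y \<bullet> h"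
    using L_eq by (metis inner_commute)
  have ray: "((\<lambda>s. R (y + s *\<^sub>R h)) has_field_derivative L h) (at 0)"
  proof -
    have "((\<lambda>s. R (y + s *\<^sub>R h)) has_derivative (\<lambda>s. L (s *\<^sub>R h))) (at 0)"
      by (rule has_derivative_compose[of "\<lambda>s. y + s *\<^sub>R h" "\<lambda>s. s *\<^sub>R h" 0 UNIV R L])
         (auto intro!: derivative_eq_intros L)
    then show ?thesis
      unfolding has_field_derivative_def
      by (rule has_derivative_eq_rhs) (auto simp: linear_scale[OF lin])
  qed
  have seq: "filterlim (\<lambda>k. inverse (real (Suc k))) (at 0) sequentially"
    unfolding filterlim_at using LIMSEQ_inverse_real_of_nat by auto
  have "(\<lambda>k. (R (y + (0 + inverse (real (Suc k))) *\<^sub>R h) - R (y + 0 *\<^sub>R h)) / inverse (real (Suc k)))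
      \<longlonglongrightarrow> L h"
    using filterlim_compose[OF ray[unfolded DERIV_def] seq] .
  then show ?thesis using Lh by simp
qed

lemma convex_step_mem:
  assumes "convex X" "y \<in> X" "z \<in> X"
  shows "y + inverse (real (Suc k)) *\<^sub>R (z - y) \<in> X"
proof -
  have "(1 - inverse (real (Suc k))) *\<^sub>R y + inverse (real (Suc k)) *\<^sub>R z \<in> X"
    using assms by (intro convexD) (auto simp: field_simps)
  then show ?thesis by (simp add: algebra_simps)
qed

text \<open>Divide the strong convexity inequality on the segment from \<open>y\<close> to \<open>z\<close> by the step length and let it tend
  to zero.\<close>

lemma strongly_convex_bregman_ge:
  fixes R :: "'v::euclidean_space \<Rightarrow> real"
  assumes sc: "strongly_convex_on X N \<sigma> R" and yz: "y \<in> X" "z \<in> X"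
    and diff: "R differentiable (at y)"
  shows "\<sigma> / 2 * (N (z - y))\<^sup>2 \<le> bregman R z y"
proof -
  have "(R (y + inverse (real (Suc k)) *\<^sub>R (z - y)) - R y) / inverse (real (Suc k))
      \<le> R z - R y - \<sigma> / 2 * (1 - inverse (real (Suc k))) * (N (z - y))\<^sup>2" for k
  proof -
    define s where "s = inverse (real (Suc k))"
    have s: "0 < s" "s \<le> 1" unfolding s_def by (auto simp: field_simps)
    have "R (s *\<^sub>R z + (1 - s) *\<^sub>R y)
        \<le> s * R z + (1 - s) * R y - \<sigma> / 2 * s * (1 - s) * (N (z - y))\<^sup>2"
      using sc yz s unfolding strongly_convex_on_def by auto
    then have "R (y + s *\<^sub>R (z - y)) - R y
        \<le> s * (R z - R y - \<sigma> / 2 * (1 - s) * (N (z - y))\<^sup>2)"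
      by (simp add: algebra_simps)
    then show ?thesis unfolding s_def[symmetric] using s by (simp add: field_simps)
  qed
  moreover have "(\<lambda>k. R z - R y - \<sigma> / 2 * (1 - inverse (real (Suc k))) * (N (z - y))\<^sup>2)
      \<longlonglongrightarrow> R z - R y - \<sigma> / 2 * (1 - 0) * (N (z - y))\<^sup>2"
    by (intro tendsto_intros LIMSEQ_inverse_real_of_nat)
  ultimately have "gradient R y \<bullet> (z - y) \<le> R z - R y - \<sigma> / 2 * (1 - 0) * (N (z - y))\<^sup>2"
    using gradient_quotients_tendsto[OF diff, of "z - y"]
    by (intro LIMSEQ_le) auto
  then show ?thesis unfolding bregman_def by simp
qed

text \<open>Moving from the minimiser \<open>x'\<close> towards another point \<open>y\<close> of \<open>X\<close> cannot lower the objective, so the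
  directional derivative there is nonnegative; the first factor below is \<open>a\<close> times the gradient of the objective
  at \<open>x'\<close>.\<close>

lemma mirror_step_optimality:
  fixes R :: "'v::euclidean_space \<Rightarrow> real"
  assumes X: "convex X" "y \<in> X" and a: "a > 0"
    and diff: "R differentiable (at x')"
    and min: "is_arg_min (\<lambda>y. v \<bullet> (y - x) + 1 / a * bregman R y x) (\<lambda>y. y \<in> X) x'"
  shows "0 \<le> (a *\<^sub>R v + gradient R x' - gradient R x) \<bullet> (y - x')"
proof -
  have x': "x' \<in> X" using min unfolding is_arg_min_def by simp
  let ?q = "\<lambda>k. (R (x' + inverse (real (Suc k)) *\<^sub>R (y - x')) - R x') / inverse (real (Suc k))"
  have "0 \<le> a * (v \<bullet> (y - x')) + ?q k - gradient R x \<bullet> (y - x')" for k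
  proof -
    define s where "s = inverse (real (Suc k))"
    have s: "0 < s" unfolding s_def by simp
    define w where "w = x' + s *\<^sub>R (y - x')"
    have "w \<in> X"
      unfolding w_def s_def by (rule convex_step_mem) (use X x' in auto)
    then have "v \<bullet> (x' - x) + 1 / a * bregman R x' x \<le> v \<bullet> (w - x) + 1 / a * bregman R w x"
      using min unfolding is_arg_min_def by (auto simp: not_less)
    then have "0 \<le> (v \<bullet> (w - x) - v \<bullet> (x' - x)) + 1 / a * (bregman R w x - bregman R x' x)"
      by (simp add: algebra_simps)
    also have "v \<bullet> (w - x) - v \<bullet> (x' - x) = s * (v \<bullet> (y - x'))"
      unfolding w_def by (simp add: inner_diff_right inner_add_right algebra_simps)
    also have "bregman R w x - bregman R x' x = R w - R x' - s * (gradient R x \<bullet> (y - x'))"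
      unfolding w_def bregman_def by (simp add: inner_diff_right inner_add_right algebra_simps)
    finally have "0 \<le> (s * (a * (v \<bullet> (y - x'))) + (R w - R x') - s * (gradient R x \<bullet> (y - x'))) / a"
      using a by (simp add: field_simps)
    then have "0 \<le> s * (a * (v \<bullet> (y - x'))) + (R w - R x') - s * (gradient R x \<bullet> (y - x'))"
      using a by (simp add: zero_le_divide_iff)
    moreover have "R w - R x' = s * ((R w - R x') / s)"
      using s by simp
    ultimately have "0 \<le> s * (a * (v \<bullet> (y - x')) + (R w - R x') / s - gradient R x \<bullet> (y - x'))"
      by (metis distrib_left right_diff_distrib)
    then show ?thesis
      using s unfolding w_def s_def[symmetric] by (simp add: zero_le_mult_iff)
  qed
  moreover have "(\<lambda>k. a * (v \<bullet> (y - x')) + ?q k - gradient R x \<bullet> (y - x'))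
      \<longlonglongrightarrow> a * (v \<bullet> (y - x')) + gradient R x' \<bullet> (y - x') - gradient R x \<bullet> (y - x')"
    by (intro tendsto_intros gradient_quotients_tendsto diff)
  ultimately have "0 \<le> a * (v \<bullet> (y - x')) + gradient R x' \<bullet> (y - x') - gradient R x \<bullet> (y - x')"
    by (intro LIMSEQ_le_const) auto
  then show ?thesis by (simp add: inner_add_left inner_diff_left)
qed

text \<open>The three-point identity for Bregman divergences turns optimality into a decrease of the divergence
  from \<open>y\<close>, up to the term \<open>a (v \<bullet> (x - x')) - bregman R x' x\<close> caused by the move from \<open>x\<close> to \<open>x'\<close>.
  Strong convexity makes this term at most quadratic in the step size.\<close>

lemma mirror_step_bregman_decrease:
  fixes R :: "'v::euclidean_space \<Rightarrow> real"
  assumes norm: "is_norm N" and \<sigma>: "\<sigma> > 0" and sc: "strongly_convex_on X N \<sigma> R"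
    and y: "y \<in> X" and x: "x \<in> X" and a: "a > 0"
    and diff: "\<And>z. z \<in> X \<Longrightarrow> R differentiable (at z)"
    and min: "is_arg_min (\<lambda>y. v \<bullet> (y - x) + 1 / a * bregman R y x) (\<lambda>y. y \<in> X) x'"
  shows "bregman R y x' \<le> bregman R y x - (a * (v \<bullet> (x - y)) - a\<^sup>2 * (dual_norm N v)\<^sup>2 / (2 * \<sigma>))"
proof -
  have x': "x' \<in> X" using min unfolding is_arg_min_def by simp
  have "convex X" using sc unfolding strongly_convex_on_def by blast
  then have "0 \<le> (a *\<^sub>R v + gradient R x' - gradient R x) \<bullet> (y - x')"
    using mirror_step_optimality[OF _ y a diff[OF x'] min] by blast
  moreover have "bregman R y x - bregman R y x' - bregman R x' x
      = (gradient R x' - gradient R x) \<bullet> (y - x')"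
    unfolding bregman_def by (simp add: inner_diff_left inner_diff_right)
  ultimately have three_point:
    "bregman R y x' \<le> bregman R y x - a * (v \<bullet> (x - y)) + a * (v \<bullet> (x - x')) - bregman R x' x"
    by (simp add: inner_diff_left inner_diff_right inner_add_left algebra_simps)
  have "N (x - x') = N (x' - x)"
  proof -
    have "N ((-1) *\<^sub>R (x' - x)) = \<bar>-1\<bar> * N (x' - x)"
      using norm unfolding is_norm_def by blast
    then show ?thesis by simp
  qed
  then have "a * (v \<bullet> (x - x')) \<le> a * (dual_norm N v * N (x' - x))"
    using inner_le_dual_norm[OF norm, of v "x - x'"] a by simp
  also have "\<dots> \<le> a\<^sup>2 * (dual_norm N v)\<^sup>2 / (2 * \<sigma>) + \<sigma> / 2 * (N (x' - x))\<^sup>2"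
  proof -
    have "0 \<le> (a * dual_norm N v - \<sigma> * N (x' - x))\<^sup>2 / (2 * \<sigma>)" using \<sigma> by simp
    also have "\<dots> = a\<^sup>2 * (dual_norm N v)\<^sup>2 / (2 * \<sigma>) + \<sigma> / 2 * (N (x' - x))\<^sup>2
        - a * (dual_norm N v * N (x' - x))"
      using \<sigma> by (simp add: field_simps power2_eq_square)
    finally show ?thesis by simp
  qed
  finally show ?thesis
    using three_point strongly_convex_bregman_ge[OF sc x x' diff[OF x]] by linarith
qed

section \<open>Summability from a conditional drift\<close>

text \<open>The sum of a nonnegative sequence, stopped just before it exceeds \<open>K\<close>. The stopping rule looks
  at the partial sum including the current term, which is possible for predictable terms and is why
  the bound is \<open>K\<close> without an overshoot.\<close>

lemma sum_stopped_le:
  fixes \<beta> :: "nat \<Rightarrow> real"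
  assumes "0 \<le> K" and nonneg: "\<And>t. 0 \<le> \<beta> t"
  shows "(\<Sum>t<n. of_bool (P \<and> (\<Sum>j\<le>t. \<beta> j) \<le> K) * \<beta> t) \<le> K"
proof (induction n)
  case (Suc n)
  show ?case
  proof (cases "P \<and> (\<Sum>j\<le>n. \<beta> j) \<le> K")
    case True
    have "(\<Sum>t<Suc n. of_bool (P \<and> (\<Sum>j\<le>t. \<beta> j) \<le> K) * \<beta> t) \<le> (\<Sum>t<Suc n. \<beta> t)"
      using nonneg by (intro sum_mono) auto
    then show ?thesis using True by (simp add: lessThan_Suc_atMost)
  next
    case False
    then have "of_bool (P \<and> (\<Sum>j\<le>n. \<beta> j) \<le> K) * \<beta> n = 0" by simp
    then show ?thesis unfolding sum.lessThan_Suc using Suc by linarith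
  qed
qed (use assms in simp)

text \<open>A pathwise decrease \<open>Y\<close> of a nonnegative process cannot add up to more than its initial value. In mean it is
  at least \<open>h - \<beta> - c\<close>, so the expected sum of \<open>h\<close> is bounded once \<open>V 0\<close> and the sum of \<open>\<beta>\<close> are.
  To achieve this, everything is multiplied by the indicator \<open>I K t\<close> of the event that \<open>V 0\<close> and
  \<open>\<beta> 0 + \<dots> + \<beta> t\<close> are at most \<open>K\<close>. This event belongs to \<open>F t\<close>, so the drift bound may be
  integrated over it, and it decreases in \<open>t\<close>, so the telescoping estimate survives. Almost every
  outcome lies in all these events for some \<open>K\<close>.

  The telescoping is done outcome by outcome, before expectations are taken, because the expectation
  of \<open>V\<close> may be infinite.\<close>

lemma (in prob_space) summable_if_conditional_drift:
  fixes F :: "nat \<Rightarrow> 'a measure" and V Y h \<beta> :: "nat \<Rightarrow> 'a \<Rightarrow> real" and c :: "nat \<Rightarrow> real"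
  assumes sub: "\<And>t. subalgebra M (F t)"
    and mono: "\<And>s t. s \<le> t \<Longrightarrow> subalgebra (F t) (F s)"
    and V0: "V 0 \<in> borel_measurable (F 0)"
    and V_nonneg: "\<And>t \<omega>. \<omega> \<in> space M \<Longrightarrow> 0 \<le> V t \<omega>"
    and step: "\<And>t \<omega>. \<omega> \<in> space M \<Longrightarrow> V (Suc t) \<omega> \<le> V t \<omega> - Y t \<omega>"
    and Y: "\<And>t. integrable M (Y t)"
    and drift: "\<And>t. AE \<omega> in M. h t \<omega> - \<beta> t \<omega> - c t \<le> real_cond_exp M (F t) (Y t) \<omega>"
    and h_meas [measurable]: "\<And>t. h t \<in> borel_measurable M"
    and h_nonneg: "\<And>t \<omega>. \<omega> \<in> space M \<Longrightarrow> 0 \<le> h t \<omega>"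
    and \<beta>_meas: "\<And>t. \<beta> t \<in> borel_measurable (F t)"
    and \<beta>_nonneg: "\<And>t \<omega>. \<omega> \<in> space M \<Longrightarrow> 0 \<le> \<beta> t \<omega>"
    and \<beta>_summable: "AE \<omega> in M. summable (\<lambda>t. \<beta> t \<omega>)"
    and c_nonneg: "\<And>t. 0 \<le> c t" and c_summable: "summable c"
  shows "AE \<omega> in M. summable (\<lambda>t. h t \<omega>)"
proof -
  define A where "A K t = {\<omega> \<in> space M. V 0 \<omega> \<le> real K \<and> (\<Sum>j\<le>t. \<beta> j \<omega>) \<le> real K}" for K t :: nat
  define I :: "nat \<Rightarrow> nat \<Rightarrow> 'a \<Rightarrow> real" where "I K t = indicator (A K t)" for K t
  have A_sets: "A K t \<in> sets (F t)" for K t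
  proof -
    have [measurable]: "V 0 \<in> borel_measurable (F t)"
      by (rule measurable_from_subalg[OF mono V0]) simp
    have [measurable]: "\<beta> j \<in> borel_measurable (F t)" if "j \<in> {..t}" for j
      by (rule measurable_from_subalg[OF mono \<beta>_meas]) (use that in simp)
    have "A K t = {\<omega> \<in> space (F t). V 0 \<omega> \<le> real K \<and> (\<Sum>j\<le>t. \<beta> j \<omega>) \<le> real K}"
      using sub[of t] unfolding A_def subalgebra_def by simp
    also have "\<dots> \<in> sets (F t)" by measurable
    finally show ?thesis .
  qed
  have I_F [measurable]: "I K t \<in> borel_measurable (F t)" for K t
    unfolding I_def using A_sets by simp
  have I_M [measurable]: "I K t \<in> borel_measurable M" for K t
    by (rule measurable_from_subalg[OF sub I_F])
  have \<beta>_M [measurable]: "\<beta> t \<in> borel_measurable M" for t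
    by (rule measurable_from_subalg[OF sub \<beta>_meas])
  have I_01: "0 \<le> I K t \<omega>" "I K t \<omega> \<le> 1" for K t \<omega>
    unfolding I_def by (auto simp: indicator_def)
  have I_dec: "I K (Suc t) \<omega> \<le> I K t \<omega>" if "\<omega> \<in> space M" for K t \<omega>
  proof -
    have "(\<Sum>j\<le>t. \<beta> j \<omega>) \<le> (\<Sum>j\<le>Suc t. \<beta> j \<omega>)" using \<beta>_nonneg[OF that] by simp
    then show ?thesis unfolding I_def A_def by (auto simp: indicator_def)
  qed
  \<comment> \<open>Since \<open>V\<close> is nonnegative, lowering its weight from \<open>I K t\<close> to \<open>I K (Suc t)\<close> only helps.\<close>
  have Y_sum: "(\<Sum>t<n. I K t \<omega> * Y t \<omega>) \<le> real K" if \<omega>: "\<omega> \<in> space M" for K n \<omega>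
  proof -
    have "(\<Sum>t<n. I K t \<omega> * Y t \<omega>) + I K n \<omega> * V n \<omega> \<le> I K 0 \<omega> * V 0 \<omega>"
    proof (induction n)
      case (Suc n)
      have "I K (Suc n) \<omega> * V (Suc n) \<omega> \<le> I K n \<omega> * V (Suc n) \<omega>"
        by (intro mult_right_mono I_dec V_nonneg \<omega>)
      also have "\<dots> \<le> I K n \<omega> * (V n \<omega> - Y n \<omega>)"
        by (intro mult_left_mono step \<omega> I_01)
      finally show ?case using Suc by (simp add: algebra_simps)
    qed simp
    moreover have "0 \<le> I K n \<omega> * V n \<omega>" using I_01 V_nonneg[OF \<omega>] by simp
    moreover have "I K 0 \<omega> * V 0 \<omega> \<le> real K"
      unfolding I_def A_def by (auto simp: indicator_def)
    ultimately show ?thesis by linarith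
  qed
  have \<beta>_sum: "(\<Sum>t<n. I K t \<omega> * \<beta> t \<omega>) \<le> real K" if "\<omega> \<in> space M" for K n \<omega>
  proof -
    have "I K t \<omega> = of_bool (V 0 \<omega> \<le> real K \<and> (\<Sum>j\<le>t. \<beta> j \<omega>) \<le> real K)" for t
      using that unfolding I_def A_def by (simp add: indicator_def)
    then show ?thesis using sum_stopped_le[of "real K" "\<lambda>t. \<beta> t \<omega>"] \<beta>_nonneg[OF that] by simp
  qed
  have int_IY: "integrable M (\<lambda>\<omega>. I K t \<omega> * Y t \<omega>)" for K t
    by (rule Bochner_Integration.integrable_bound[OF Y[of t]])
       (use I_01 Y[of t] in \<open>auto simp: abs_mult mult_left_le_one_le\<close>)
  have int_I\<beta>: "integrable M (\<lambda>\<omega>. I K t \<omega> * \<beta> t \<omega>)" for K t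
  proof (rule integrable_const_bound[where B = "real K"])
    show "AE \<omega> in M. norm (I K t \<omega> * \<beta> t \<omega>) \<le> real K"
    proof (rule AE_I2)
      fix \<omega> assume \<omega>: "\<omega> \<in> space M"
      have "I K t \<omega> * \<beta> t \<omega> \<le> (\<Sum>j<Suc t. I K j \<omega> * \<beta> j \<omega>)"
        using I_01 \<beta>_nonneg[OF \<omega>] by (intro member_le_sum) auto
      also have "\<dots> \<le> real K" by (rule \<beta>_sum[OF \<omega>])
      finally show "norm (I K t \<omega> * \<beta> t \<omega>) \<le> real K"
        using I_01 \<beta>_nonneg[OF \<omega>] by (simp add: abs_mult)
    qed
  qed measurable
  have int_I: "integrable M (\<lambda>\<omega>. I K t \<omega> * c t)" for K t
    by (rule integrable_const_bound[where B = "c t"])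
       (use I_01 c_nonneg in \<open>auto simp: abs_mult mult_left_le_one_le\<close>)
  \<comment> \<open>The weight \<open>I K t\<close> is \<open>F t\<close>-measurable, so \<open>Y t\<close> may be replaced by its conditional expectation.\<close>
  have drift_I: "integrable M (\<lambda>\<omega>. I K t \<omega> * h t \<omega>)"
    "(\<integral>\<omega>. I K t \<omega> * h t \<omega> \<partial>M)
      \<le> (\<integral>\<omega>. I K t \<omega> * Y t \<omega> \<partial>M) + (\<integral>\<omega>. I K t \<omega> * \<beta> t \<omega> \<partial>M) + c t" for K t
  proof -
    interpret S: finite_measure_subalgebra M "F t"
      by unfold_locales (rule sub)
    let ?E = "\<lambda>\<omega>. I K t \<omega> * real_cond_exp M (F t) (Y t) \<omega>"
    note E = S.real_cond_exp_intg[OF int_IY I_F borel_measurable_integrable[OF Y]]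
    have le: "AE \<omega> in M. I K t \<omega> * h t \<omega> \<le> ?E \<omega> + I K t \<omega> * \<beta> t \<omega> + I K t \<omega> * c t"
      using drift[of t]
    proof eventually_elim
      case (elim \<omega>)
      have "I K t \<omega> * (h t \<omega> - \<beta> t \<omega> - c t) \<le> ?E \<omega>"
        by (intro mult_left_mono elim I_01)
      then show ?case by (simp add: algebra_simps)
    qed
    have int_sum: "integrable M (\<lambda>\<omega>. ?E \<omega> + I K t \<omega> * \<beta> t \<omega> + I K t \<omega> * c t)"
      using E(1) int_I\<beta> int_I by (intro Bochner_Integration.integrable_add)
    show int_h: "integrable M (\<lambda>\<omega>. I K t \<omega> * h t \<omega>)"
    proof (rule Bochner_Integration.integrable_bound[OF int_sum])
      show "AE \<omega> in M. norm (I K t \<omega> * h t \<omega>)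
          \<le> norm (?E \<omega> + I K t \<omega> * \<beta> t \<omega> + I K t \<omega> * c t)"
        using le AE_space
      proof eventually_elim
        case (elim \<omega>)
        have "0 \<le> I K t \<omega> * h t \<omega>" using I_01 h_nonneg[OF elim(2)] by simp
        then show ?case using elim(1) by simp
      qed
    qed measurable
    have "(\<integral>\<omega>. I K t \<omega> * h t \<omega> \<partial>M)
        \<le> (\<integral>\<omega>. ?E \<omega> + I K t \<omega> * \<beta> t \<omega> + I K t \<omega> * c t \<partial>M)"
      by (rule integral_mono_AE[OF int_h int_sum le])
    also have "\<dots> = (\<integral>\<omega>. I K t \<omega> * Y t \<omega> \<partial>M) + (\<integral>\<omega>. I K t \<omega> * \<beta> t \<omega> \<partial>M) + (\<integral>\<omega>. I K t \<omega> * c t \<partial>M)"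
      using E int_I\<beta>[of K t] int_I[of K t] by simp
    also have "(\<integral>\<omega>. I K t \<omega> * c t \<partial>M) \<le> (\<integral>\<omega>. c t \<partial>M)"
      using I_01 c_nonneg int_I by (intro integral_mono) (auto simp: mult_left_le_one_le)
    finally show "(\<integral>\<omega>. I K t \<omega> * h t \<omega> \<partial>M)
      \<le> (\<integral>\<omega>. I K t \<omega> * Y t \<omega> \<partial>M) + (\<integral>\<omega>. I K t \<omega> * \<beta> t \<omega> \<partial>M) + c t"
      by (simp add: prob_space)
  qed
  have h_sum: "(\<Sum>t<n. \<integral>\<omega>. I K t \<omega> * h t \<omega> \<partial>M) \<le> 2 * real K + suminf c" for K n
  proof -
    have "(\<Sum>t<n. \<integral>\<omega>. I K t \<omega> * h t \<omega> \<partial>M)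
        \<le> (\<Sum>t<n. (\<integral>\<omega>. I K t \<omega> * Y t \<omega> \<partial>M) + (\<integral>\<omega>. I K t \<omega> * \<beta> t \<omega> \<partial>M) + c t)"
      by (intro sum_mono drift_I)
    also have "\<dots> = (\<integral>\<omega>. (\<Sum>t<n. I K t \<omega> * Y t \<omega>) \<partial>M) + (\<integral>\<omega>. (\<Sum>t<n. I K t \<omega> * \<beta> t \<omega>) \<partial>M)
        + (\<Sum>t<n. c t)"
      by (simp add: sum.distrib int_IY int_I\<beta>)
    also have "\<dots> \<le> real K + real K + suminf c"
      by (intro add_mono integral_le_const Bochner_Integration.integrable_sum int_IY int_I\<beta> AE_I2 Y_sum \<beta>_sum
            sum_le_suminf c_summable c_nonneg) auto
    finally show ?thesis by simp
  qed
  have "AE \<omega> in M. summable (\<lambda>t. I K t \<omega> * h t \<omega>)" for K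
  proof -
    have Ih_nonneg: "0 \<le> I K t \<omega> * h t \<omega>" if "\<omega> \<in> space M" for t \<omega>
      using I_01 h_nonneg[OF that] by simp
    have "summable (\<lambda>t. \<integral>\<omega>. I K t \<omega> * h t \<omega> \<partial>M)"
      by (rule summableI_nonneg_bounded[OF _ h_sum])
         (auto intro!: Bochner_Integration.integral_nonneg Ih_nonneg)
    then have "(\<Sum>t. ennreal (\<integral>\<omega>. I K t \<omega> * h t \<omega> \<partial>M)) \<noteq> top"
      by (intro ennreal_suminf_neq_top)
         (auto intro!: Bochner_Integration.integral_nonneg Ih_nonneg)
    also have "(\<Sum>t. ennreal (\<integral>\<omega>. I K t \<omega> * h t \<omega> \<partial>M)) = (\<Sum>t. \<integral>\<^sup>+\<omega>. ennreal (I K t \<omega> * h t \<omega>) \<partial>M)"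
      by (intro suminf_cong nn_integral_eq_integral[symmetric] drift_I AE_I2 Ih_nonneg)
    also have "\<dots> = (\<integral>\<^sup>+\<omega>. (\<Sum>t. ennreal (I K t \<omega> * h t \<omega>)) \<partial>M)"
      by (rule nn_integral_suminf[symmetric]) measurable
    finally have "AE \<omega> in M. (\<Sum>t. ennreal (I K t \<omega> * h t \<omega>)) \<noteq> \<infinity>"
      by (intro nn_integral_PInf_AE) (auto simp: infinity_ennreal_def)
    then show ?thesis
      using AE_space
      by eventually_elim (rule summable_suminf_not_top, auto intro: Ih_nonneg)
  qed
  then have "AE \<omega> in M. \<forall>K. summable (\<lambda>t. I K t \<omega> * h t \<omega>)"
    by (simp add: AE_all_countable)
  then show ?thesis
    using \<beta>_summable AE_space
  proof eventually_elim
    case (elim \<omega>)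
    obtain K where K: "max (V 0 \<omega>) (\<Sum>t. \<beta> t \<omega>) \<le> real K"
      using real_arch_simple by blast
    have "(\<Sum>j\<le>t. \<beta> j \<omega>) \<le> real K" for t
      using sum_le_suminf[OF elim(2), of "{..t}"] \<beta>_nonneg[OF elim(3)] K by force
    then have "I K t \<omega> = 1" for t
      using K elim(3) unfolding I_def A_def by (auto simp: indicator_def)
    then show ?case using elim(1)[rule_format, of K] by simp
  qed
qed

section \<open>Conditional expectations and the history of the iterates\<close>

lemma space_history: "space (history M x t) = space M"
  unfolding history_def by (simp add: space_measure_of_conv)

lemma sets_history:
  "sets (history M x t)
    = sigma_sets (space M) {x j -` A \<inter> space M | j A. j \<in> {1..t} \<and> A \<in> sets borel}"
  unfolding history_def by (rule sets_measure_of) auto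

lemma subalgebra_history:
  assumes "\<And>j. j \<in> {1..t} \<Longrightarrow> x j \<in> borel_measurable M"
  shows "subalgebra M (history M x t)"
proof -
  have "{x j -` A \<inter> space M | j A. j \<in> {1..t} \<and> A \<in> sets borel} \<subseteq> sets M"
    using measurable_sets[OF assms] by blast
  then show ?thesis
    unfolding subalgebra_def space_history sets_history
    by (intro conjI refl sets.sigma_sets_subset)
qed

lemma subalgebra_history_mono:
  assumes "s \<le> t"
  shows "subalgebra (history M x t) (history M x s)"
proof -
  have "{1..s} \<subseteq> {1..t}" using assms by simp
  then have "{x j -` A \<inter> space M | j A. j \<in> {1..s} \<and> A \<in> sets borel}
      \<subseteq> {x j -` A \<inter> space M | j A. j \<in> {1..t} \<and> A \<in> sets borel}"
    by blast
  then show ?thesis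
    unfolding subalgebra_def space_history sets_history
    by (intro conjI refl sigma_sets_mono')
qed

lemma measurable_history:
  fixes x :: "nat \<Rightarrow> 'w \<Rightarrow> 'v::topological_space"
  assumes "j \<in> {1..t}"
  shows "x j \<in> borel_measurable (history M x t)"
proof (rule measurableI)
  fix A :: "'v set" assume "A \<in> sets borel"
  then show "x j -` A \<inter> space (history M x t) \<in> sets (history M x t)"
    unfolding space_history sets_history using assms by (intro sigma_sets.Basic) blast
qed simp

text \<open>\<open>R\<close> is controlled on \<open>X\<close> only, and its gradient need not be continuous. But in the direction of \<open>p\<close> the
  difference quotients use values of \<open>R\<close> on the convex set \<open>X\<close>, where it is continuous, and the directional
  derivative is their pointwise limit.\<close>

lemma borel_measurable_bregman:
  fixes R :: "'v::euclidean_space \<Rightarrow> real"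
  assumes X: "convex X" "closed X" "p \<in> X"
    and diff: "\<And>z. z \<in> X \<Longrightarrow> R differentiable (at z)"
    and u: "u \<in> borel_measurable F" "\<And>\<omega>. \<omega> \<in> space F \<Longrightarrow> u \<omega> \<in> X"
  shows "(\<lambda>\<omega>. bregman R p (u \<omega>)) \<in> borel_measurable F"
proof -
  have "continuous_on X R"
    using diff by (intro continuous_at_imp_continuous_on ballI differentiable_imp_continuous_within) auto
  then have "R \<in> borel_measurable (restrict_space borel X)"
    by (rule borel_measurable_continuous_on_restrict)
  then have R_comp: "(\<lambda>\<omega>. R (w \<omega>)) \<in> borel_measurable F"
    if "w \<in> borel_measurable F" "\<And>\<omega>. \<omega> \<in> space F \<Longrightarrow> w \<omega> \<in> X" for w
    using that by (intro measurable_compose[of w F "restrict_space borel X" R borel] measurable_restrict_space2) auto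
  have "(\<lambda>\<omega>. (R (u \<omega> + inverse (real (Suc k)) *\<^sub>R (p - u \<omega>)) - R (u \<omega>)) / inverse (real (Suc k)))
      \<in> borel_measurable F" for k
    by (intro borel_measurable_divide borel_measurable_diff R_comp convex_step_mem X u
          borel_measurable_add borel_measurable_scaleR borel_measurable_const) auto
  from borel_measurable_LIMSEQ_real[OF gradient_quotients_tendsto[OF diff[OF u(2)]] this]
  have [measurable]: "(\<lambda>\<omega>. gradient R (u \<omega>) \<bullet> (p - u \<omega>)) \<in> borel_measurable F" .
  have [measurable]: "(\<lambda>\<omega>. R (u \<omega>)) \<in> borel_measurable F"
    by (rule R_comp) (use u in auto)
  show ?thesis unfolding bregman_def by measurable
qed

text \<open>Pulling a bounded known vector out of the conditional expectation, one coordinate at a time.\<close>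

lemma (in finite_measure_subalgebra) real_cond_exp_inner:
  fixes Y Z :: "'a \<Rightarrow> real ^ 'n"
  assumes Y: "integrable M Y" and Z: "Z \<in> borel_measurable F"
    and bnd: "\<And>\<omega>. \<omega> \<in> space M \<Longrightarrow> norm (Z \<omega>) \<le> B"
  shows "integrable M (\<lambda>\<omega>. Y \<omega> \<bullet> Z \<omega>)"
    "AE \<omega> in M. real_cond_exp M F (\<lambda>\<omega>. Y \<omega> \<bullet> Z \<omega>) \<omega> = vec_cond_exp M F Y \<omega> \<bullet> Z \<omega>"
proof -
  have Zi [measurable]: "(\<lambda>\<omega>. Z \<omega> $ i) \<in> borel_measurable F" for i
    unfolding cart_eq_inner_axis using Z by (intro borel_measurable_inner) auto
  have Zi_M [measurable]: "(\<lambda>\<omega>. Z \<omega> $ i) \<in> borel_measurable M" for i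
    by (rule measurable_from_subalg[OF subalg Zi])
  have Yi: "integrable M (\<lambda>\<omega>. Y \<omega> $ i)" for i
    using integrable_inner_left[OF Y, of "axis i 1"] by (simp add: cart_eq_inner_axis)
  have Yi_M [measurable]: "(\<lambda>\<omega>. Y \<omega> $ i) \<in> borel_measurable M" for i
    using Yi by auto
  have int: "integrable M (\<lambda>\<omega>. Z \<omega> $ i * Y \<omega> $ i)" for i
  proof (rule Bochner_Integration.integrable_bound)
    show "integrable M (\<lambda>\<omega>. B * Y \<omega> $ i)" using Yi by simp
    show "AE \<omega> in M. norm (Z \<omega> $ i * Y \<omega> $ i) \<le> norm (B * Y \<omega> $ i)"
    proof (rule AE_I2)
      fix \<omega> assume "\<omega> \<in> space M"
      then have "\<bar>Z \<omega> $ i\<bar> \<le> \<bar>B\<bar>"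
        using bnd[of \<omega>] component_le_norm_cart[of "Z \<omega>" i] by linarith
      then show "norm (Z \<omega> $ i * Y \<omega> $ i) \<le> norm (B * Y \<omega> $ i)"
        by (simp add: abs_mult mult_right_mono)
    qed
  qed measurable
  have eq: "(\<lambda>\<omega>. Y \<omega> \<bullet> Z \<omega>) = (\<lambda>\<omega>. \<Sum>i\<in>UNIV. Z \<omega> $ i * Y \<omega> $ i)"
    by (simp add: inner_vec_def mult.commute)
  show "integrable M (\<lambda>\<omega>. Y \<omega> \<bullet> Z \<omega>)"
    unfolding eq by (intro Bochner_Integration.integrable_sum int)
  have "AE \<omega> in M. \<forall>i. real_cond_exp M F (\<lambda>\<omega>. Z \<omega> $ i * Y \<omega> $ i) \<omega>
      = Z \<omega> $ i * real_cond_exp M F (\<lambda>\<omega>. Y \<omega> $ i) \<omega>"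
    by (subst AE_all_countable) (intro allI real_cond_exp_mult Zi Yi_M int)
  with real_cond_exp_sum[where I = UNIV, OF int]
  show "AE \<omega> in M. real_cond_exp M F (\<lambda>\<omega>. Y \<omega> \<bullet> Z \<omega>) \<omega> = vec_cond_exp M F Y \<omega> \<bullet> Z \<omega>"
    unfolding eq
    by eventually_elim (simp add: inner_vec_def vec_cond_exp_def mult.commute)
qed

text \<open>A bound on the conditional expectation in the extended nonnegative sense, which exists for every
  nonnegative function, already forces integrability. So it carries over to the real-valued
  conditional expectation.\<close>

lemma (in finite_measure_subalgebra) real_cond_exp_le_of_nn_cond_exp_le:
  assumes f [measurable]: "f \<in> borel_measurable M" and nonneg: "\<And>\<omega>. 0 \<le> f \<omega>" and c: "0 \<le> c"
    and le: "AE \<omega> in M. nn_cond_exp M F (\<lambda>\<omega>. ennreal (f \<omega>)) \<omega> \<le> ennreal c"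
  shows "integrable M f" "AE \<omega> in M. real_cond_exp M F f \<omega> \<le> c"
proof -
  have "(\<integral>\<^sup>+\<omega>. ennreal (f \<omega>) \<partial>M) = (\<integral>\<^sup>+\<omega>. nn_cond_exp M F (\<lambda>\<omega>. ennreal (f \<omega>)) \<omega> \<partial>M)"
    using nn_cond_exp_intg[of "\<lambda>_. 1" "\<lambda>\<omega>. ennreal (f \<omega>)"] by simp
  also have "\<dots> \<le> (\<integral>\<^sup>+\<omega>. ennreal c \<partial>M)"
    by (rule nn_integral_mono_AE[OF le])
  also have "\<dots> < \<infinity>"
    by (simp add: emeasure_eq_measure ennreal_mult'[symmetric] c)
  finally show "integrable M f"
    using nonneg by (intro integrableI_nonneg) auto
  show "AE \<omega> in M. real_cond_exp M F f \<omega> \<le> c"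
    using le
  proof eventually_elim
    case (elim \<omega>)
    have "enn2real (nn_cond_exp M F (\<lambda>\<omega>. ennreal (f \<omega>)) \<omega>) \<le> c"
      using enn2real_mono[OF elim] c by simp
    then show ?case
      unfolding real_cond_exp_def
      using enn2real_nonneg[of "nn_cond_exp M F (\<lambda>\<omega>. ennreal (- f \<omega>)) \<omega>"] by linarith
  qed
qed

section \<open>Averaged iterates of stochastic mirror descent\<close>

text \<open>Jensen's inequality, multiplied by the total weight. Membership in \<open>X\<close> keeps the average at or above
  the minimum of \<open>f\<close> on \<open>X\<close>.\<close>

lemma weighted_average_mem_and_le:
  fixes y :: "nat \<Rightarrow> 'v::real_vector"
  assumes f: "convex_on X f" and pos: "\<And>j. j \<ge> 1 \<Longrightarrow> \<alpha> j > 0"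
    and y: "\<And>j. j \<ge> 1 \<Longrightarrow> y j \<in> X" and t: "t \<ge> 1"
  shows "weighted_average \<alpha> y t \<in> X"
    "(\<Sum>j=1..t. \<alpha> j) * f (weighted_average \<alpha> y t) \<le> (\<Sum>j=1..t. \<alpha> j * f (y j))"
proof -
  define S where "S = (\<Sum>j=1..t. \<alpha> j)"
  have S: "S > 0" unfolding S_def using pos t by (intro sum_pos) auto
  have avg: "weighted_average \<alpha> y t = (\<Sum>j=1..t. (\<alpha> j / S) *\<^sub>R y j)"
    unfolding weighted_average_def S_def[symmetric]
    by (simp add: scaleR_sum_right divide_inverse mult.commute)
  have one: "(\<Sum>j=1..t. \<alpha> j / S) = 1"
    using S unfolding sum_divide_distrib[symmetric] S_def[symmetric] by simp
  have nonneg: "0 \<le> \<alpha> j / S" if "j \<in> {1..t}" for j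
    using S pos[of j] that by auto
  show "weighted_average \<alpha> y t \<in> X"
    unfolding avg using convex_on_imp_convex[OF f] one nonneg y by (intro convex_sum) auto
  have "f (weighted_average \<alpha> y t) \<le> (\<Sum>j=1..t. \<alpha> j / S * f (y j))"
    unfolding avg using t nonneg y by (intro convex_on_sum[OF _ _ f one]) auto
  also have "\<dots> = (\<Sum>j=1..t. \<alpha> j * f (y j)) / S"
    by (simp add: sum_divide_distrib)
  finally show "(\<Sum>j=1..t. \<alpha> j) * f (weighted_average \<alpha> y t) \<le> (\<Sum>j=1..t. \<alpha> j * f (y j))"
    unfolding S_def[symmetric] using S by (simp add: pos_le_divide_eq mult.commute)
qed

theorem theorem3:
  fixes N :: "real ^ 'n \<Rightarrow> real"
    and X U :: "(real ^ 'n) set"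
    and f R :: "real ^ 'n \<Rightarrow> real"
    and \<sigma> \<nu> :: real
    and M :: "'w measure"
    and \<alpha> :: "nat \<Rightarrow> real"
    and x gt g b :: "nat \<Rightarrow> 'w \<Rightarrow> real ^ 'n"
  assumes norm: "is_norm N"
    and X: "X \<noteq> {}" "convex X" "compact X"
    and f: "convex_on UNIV f" "continuous_on UNIV f"
    and R: "\<sigma> > 0" "strongly_convex_on X N \<sigma> R"
           "open U" "X \<subseteq> U" "\<forall>y\<in>U. R differentiable (at y)"
    and M: "prob_space M"
    and step_pos: "\<forall>t\<ge>1. \<alpha> t > 0"
    and x_meas: "\<forall>t\<ge>1. x t \<in> borel_measurable M"
    and gt_meas: "\<forall>t\<ge>1. gt t \<in> borel_measurable M"
    and init: "\<forall>\<omega>\<in>space M. x 1 \<omega> \<in> X"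
    and mirror_descent:
      "\<forall>t\<ge>1. \<forall>\<omega>\<in>space M.
         is_arg_min (\<lambda>y. gt t \<omega> \<bullet> (y - x t \<omega>) + 1 / \<alpha> t * bregman R y (x t \<omega>))
                    (\<lambda>y. y \<in> X) (x (t + 1) \<omega>)"
    and A1_subgradient: "\<forall>t\<ge>1. \<forall>\<omega>\<in>space M. g t \<omega> \<in> subdifferential f (x t \<omega>)"
    and A1_bias: "\<forall>t\<ge>1. b t \<in> borel_measurable (history M x t)"
    and A1_mean:
      "\<forall>t\<ge>1. AE \<omega> in M. vec_cond_exp M (history M x t) (gt t) \<omega> = g t \<omega> + b t \<omega>"
    and A1_second_moment:
      "\<forall>t\<ge>1. AE \<omega> in M.
         nn_cond_exp M (history M x t) (\<lambda>\<omega>'. ennreal ((dual_norm N (gt t \<omega>'))\<^sup>2)) \<omega> \<le> ennreal (\<nu>\<^sup>2)"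
    and A2_divergent: "filterlim (\<lambda>T. \<Sum>t=1..T. \<alpha> t) at_top sequentially"
    and A2_square_summable: "summable (\<lambda>t. (\<alpha> (Suc t))\<^sup>2)"
    and A3: "AE \<omega> in M. summable (\<lambda>t. \<alpha> (Suc t) * dual_norm N (b (Suc t) \<omega>))"
  shows "bigo_as M
           (\<lambda>t \<omega>. f (weighted_average \<alpha> (\<lambda>j. x j \<omega>) t) - (INF y\<in>X. f y))
           (\<lambda>t. 1 / (\<Sum>j=1..t. \<alpha> j))"
proof -
  interpret prob_space M by (rule M)
  \<comment> \<open>The time index is shifted: the drift lemma counts from \<open>0\<close>, the algorithm from \<open>1\<close>.\<close>
  define F where "F t = history M x (Suc t)" for t
  have sub: "subalgebra M (F t)" for t
    unfolding F_def using x_meas by (intro subalgebra_history) auto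
  have x_F [measurable]: "x (Suc t) \<in> borel_measurable (F t)" for t
    unfolding F_def by (rule measurable_history) simp
  have pos: "\<alpha> (Suc t) > 0" for t using step_pos by simp
  have diff: "R differentiable (at z)" if "z \<in> X" for z using R that by blast
  have x_X: "x (Suc t) \<omega> \<in> X" if "\<omega> \<in> space M" for t \<omega>
  proof (cases t)
    case (Suc s)
    then show ?thesis
      using mirror_descent that unfolding is_arg_min_def by (metis Suc_eq_plus1 Suc_leI zero_less_Suc One_nat_def)
  qed (use init that in simp)

  obtain p where p: "p \<in> X" "\<And>y. y \<in> X \<Longrightarrow> f p \<le> f y"
    using continuous_attains_inf[OF X(3,1) continuous_on_subset[OF f(2)]] by blast
  have INF_f: "(INF y\<in>X. f y) = f p"
    using p by (intro cInf_eq_minimum) auto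

  obtain C where C: "\<And>y. N y \<le> C * norm y" "C > 0"
    using is_norm_equivalent_norm[OF norm] by metis
  obtain r where r: "\<And>y. y \<in> X \<Longrightarrow> norm (y - p) \<le> r" "r \<ge> 0"
  proof -
    have "bounded ((\<lambda>y. y - p) ` X)"
      using X(3) by (intro compact_imp_bounded compact_continuous_image continuous_intros)
    then obtain B where "\<And>y. y \<in> X \<Longrightarrow> norm (y - p) \<le> B"
      unfolding bounded_iff by auto
    moreover from this[OF p(1)] have "B \<ge> 0" by simp
    ultimately show thesis using that by blast
  qed
  obtain D where D: "\<And>y. y \<in> X \<Longrightarrow> N (p - y) \<le> D" "D \<ge> 0"
  proof
    show "C * r \<ge> 0" using C r by simp
    fix y assume "y \<in> X"
    then have "C * norm (p - y) \<le> C * r"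
      using r(1)[of y] C(2) by (simp add: norm_minus_commute[of p y])
    then show "N (p - y) \<le> C * r" using C(1)[of "p - y"] by linarith
  qed

  define V where "V t \<omega> = bregman R p (x (Suc t) \<omega>)" for t \<omega>
  define Y where "Y t \<omega> = \<alpha> (Suc t) * (gt (Suc t) \<omega> \<bullet> (x (Suc t) \<omega> - p))
    - (\<alpha> (Suc t))\<^sup>2 / (2 * \<sigma>) * (dual_norm N (gt (Suc t) \<omega>))\<^sup>2" for t \<omega>
  define h where "h t \<omega> = \<alpha> (Suc t) * (f (x (Suc t) \<omega>) - f p)" for t \<omega>
  define \<beta> where "\<beta> t \<omega> = D * (\<alpha> (Suc t) * dual_norm N (b (Suc t) \<omega>))" for t \<omega>
  define e where "e t = \<nu>\<^sup>2 / (2 * \<sigma>) * (\<alpha> (Suc t))\<^sup>2" for t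

  have dual_meas [measurable]: "dual_norm N \<in> borel_measurable borel"
    by (rule borel_measurable_continuous_onI[OF continuous_on_dual_norm[OF norm]])
  have f_meas [measurable]: "f \<in> borel_measurable borel"
    by (rule borel_measurable_continuous_onI[OF f(2)])
  have gt_M [measurable]: "gt (Suc t) \<in> borel_measurable M" for t using gt_meas by simp
  have x_M [measurable]: "x (Suc t) \<in> borel_measurable M" for t using x_meas by simp
  have b_F [measurable]: "b (Suc t) \<in> borel_measurable (F t)" for t
    unfolding F_def using A1_bias by simp

  have Y_drift: "integrable M (Y t)"
    "AE \<omega> in M. h t \<omega> - \<beta> t \<omega> - e t \<le> real_cond_exp M (F t) (Y t) \<omega>" for t
  proof -
    interpret S: finite_measure_subalgebra M "F t"
      by unfold_locales (rule sub)
    let ?sq = "\<lambda>\<omega>. (dual_norm N (gt (Suc t) \<omega>))\<^sup>2"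
    let ?ip = "\<lambda>\<omega>. gt (Suc t) \<omega> \<bullet> (x (Suc t) \<omega> - p)"
    have sq: "integrable M ?sq" "AE \<omega> in M. real_cond_exp M (F t) ?sq \<omega> \<le> \<nu>\<^sup>2"
      using S.real_cond_exp_le_of_nn_cond_exp_le[of ?sq "\<nu>\<^sup>2"] A1_second_moment
      unfolding F_def by auto
    have gt_int: "integrable M (gt (Suc t))"
    proof -
      \<comment> \<open>Bounding \<open>d\<close> by \<open>1 + d\<^sup>2\<close> reduces the first moment to the second.\<close>
      obtain E where E: "E > 0" "\<And>v. norm v \<le> E * dual_norm N v"
        using norm_le_dual_norm[OF norm] by blast
      show ?thesis
      proof (rule Bochner_Integration.integrable_bound)
        show "integrable M (\<lambda>\<omega>. E * (1 + ?sq \<omega>))" using sq(1) by simp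
        show "AE \<omega> in M. norm (gt (Suc t) \<omega>) \<le> norm (E * (1 + ?sq \<omega>))"
        proof (rule AE_I2)
          fix \<omega>
          have le: "d \<le> 1 + d\<^sup>2" for d :: real
            using zero_le_power2[of "d - 1 / 2"] by (simp add: power2_eq_square algebra_simps)
          have "norm (gt (Suc t) \<omega>) \<le> E * dual_norm N (gt (Suc t) \<omega>)" by (rule E)
          also have "\<dots> \<le> E * (1 + ?sq \<omega>)" using E(1) le by simp
          finally show "norm (gt (Suc t) \<omega>) \<le> norm (E * (1 + ?sq \<omega>))" by simp
        qed
      qed measurable
    qed
    have ip: "integrable M ?ip"
      "AE \<omega> in M. real_cond_exp M (F t) ?ip \<omega> = vec_cond_exp M (F t) (gt (Suc t)) \<omega> \<bullet> (x (Suc t) \<omega> - p)"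
      using S.real_cond_exp_inner[OF gt_int, of "\<lambda>\<omega>. x (Suc t) \<omega> - p" r] r(1) x_X by auto
    have Y_eq: "Y t = (\<lambda>\<omega>. \<alpha> (Suc t) * ?ip \<omega> - (\<alpha> (Suc t))\<^sup>2 / (2 * \<sigma>) * ?sq \<omega>)"
      unfolding Y_def by simp
    have ints: "integrable M (\<lambda>\<omega>. \<alpha> (Suc t) * ?ip \<omega>)"
      "integrable M (\<lambda>\<omega>. (\<alpha> (Suc t))\<^sup>2 / (2 * \<sigma>) * ?sq \<omega>)"
      using ip(1) sq(1) by (auto intro: integrable_mult_right)
    show "integrable M (Y t)"
      unfolding Y_eq by (rule Bochner_Integration.integrable_diff[OF ints])
    have mean: "AE \<omega> in M. vec_cond_exp M (F t) (gt (Suc t)) \<omega> = g (Suc t) \<omega> + b (Suc t) \<omega>"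
      unfolding F_def using A1_mean by simp
    show "AE \<omega> in M. h t \<omega> - \<beta> t \<omega> - e t \<le> real_cond_exp M (F t) (Y t) \<omega>"
      using S.real_cond_exp_diff[OF ints] S.real_cond_exp_cmult[OF ip(1), of "\<alpha> (Suc t)"]
        S.real_cond_exp_cmult[OF sq(1), of "(\<alpha> (Suc t))\<^sup>2 / (2 * \<sigma>)"] ip(2) sq(2) mean AE_space
    proof eventually_elim
      case (elim \<omega>)
      have "real_cond_exp M (F t) (Y t) \<omega>
          = \<alpha> (Suc t) * ((g (Suc t) \<omega> + b (Suc t) \<omega>) \<bullet> (x (Suc t) \<omega> - p))
            - (\<alpha> (Suc t))\<^sup>2 / (2 * \<sigma>) * real_cond_exp M (F t) ?sq \<omega>"
        unfolding Y_eq using elim by simp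
      moreover have "(\<alpha> (Suc t))\<^sup>2 / (2 * \<sigma>) * real_cond_exp M (F t) ?sq \<omega> \<le> e t"
        unfolding e_def using mult_left_mono[OF elim(5), of "(\<alpha> (Suc t))\<^sup>2 / (2 * \<sigma>)"] R(1)
        by (simp add: mult.commute)
      moreover have "h t \<omega> - \<beta> t \<omega> \<le> \<alpha> (Suc t) * ((g (Suc t) \<omega> + b (Suc t) \<omega>) \<bullet> (x (Suc t) \<omega> - p))"
      proof -
        have "f p \<ge> f (x (Suc t) \<omega>) + g (Suc t) \<omega> \<bullet> (p - x (Suc t) \<omega>)"
          using A1_subgradient elim(7) unfolding subdifferential_def by auto
        moreover have "b (Suc t) \<omega> \<bullet> (p - x (Suc t) \<omega>) \<le> dual_norm N (b (Suc t) \<omega>) * D"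
          using inner_le_dual_norm[OF norm, of "b (Suc t) \<omega>" "p - x (Suc t) \<omega>"]
            mult_left_mono[OF D(1)[OF x_X[OF elim(7)]] dual_norm_nonneg[OF norm]]
          by (rule order_trans)
        ultimately have "f (x (Suc t) \<omega>) - f p - dual_norm N (b (Suc t) \<omega>) * D
            \<le> (g (Suc t) \<omega> + b (Suc t) \<omega>) \<bullet> (x (Suc t) \<omega> - p)"
          by (simp add: inner_add_left inner_diff_right)
        from mult_left_mono[OF this, of "\<alpha> (Suc t)"] pos[of t] show ?thesis
          unfolding h_def \<beta>_def by (simp add: algebra_simps)
      qed
      ultimately show ?case by linarith
    qed
  qed

  have "AE \<omega> in M. summable (\<lambda>t. h t \<omega>)"
  proof (rule summable_if_conditional_drift[where F = F and V = V and Y = Y and \<beta> = \<beta> and c = e])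
    show "subalgebra (F t) (F s)" if "s \<le> t" for s t
      unfolding F_def using that by (intro subalgebra_history_mono) simp
    show "V 0 \<in> borel_measurable (F 0)"
      unfolding V_def
      by (rule borel_measurable_bregman[OF X(2) compact_imp_closed[OF X(3)] p(1) diff])
         (use x_F x_X in \<open>auto simp: F_def space_history\<close>)
    show "0 \<le> V t \<omega>" if "\<omega> \<in> space M" for t \<omega>
    proof -
      have "0 \<le> \<sigma> / 2 * (N (p - x (Suc t) \<omega>))\<^sup>2" using R(1) by simp
      also have "\<dots> \<le> V t \<omega>"
        unfolding V_def
        by (rule strongly_convex_bregman_ge[OF R(2)]) (use that x_X p diff in auto)
      finally show ?thesis .
    qed
    show "V (Suc t) \<omega> \<le> V t \<omega> - Y t \<omega>" if "\<omega> \<in> space M" for t \<omega>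
    proof -
      have "bregman R p (x (Suc (Suc t)) \<omega>) \<le> bregman R p (x (Suc t) \<omega>)
          - (\<alpha> (Suc t) * (gt (Suc t) \<omega> \<bullet> (x (Suc t) \<omega> - p))
             - (\<alpha> (Suc t))\<^sup>2 * (dual_norm N (gt (Suc t) \<omega>))\<^sup>2 / (2 * \<sigma>))"
        using mirror_descent[rule_format, of "Suc t" \<omega>] that
        by (intro mirror_step_bregman_decrease[OF norm R(1,2) p(1) x_X pos diff]) auto
      then show ?thesis unfolding V_def Y_def by simp
    qed
    show "h t \<in> borel_measurable M" for t unfolding h_def by measurable
    show "0 \<le> h t \<omega>" if "\<omega> \<in> space M" for t \<omega>
      unfolding h_def using pos[of t] p(2)[OF x_X[OF that]] by simp
    show "\<beta> t \<in> borel_measurable (F t)" for t unfolding \<beta>_def by measurable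
    show "0 \<le> \<beta> t \<omega>" for t \<omega>
      unfolding \<beta>_def using D(2) pos[of t] dual_norm_nonneg[OF norm] by simp
    show "AE \<omega> in M. summable (\<lambda>t. \<beta> t \<omega>)"
      using A3 unfolding \<beta>_def by eventually_elim (rule summable_mult)
    show "0 \<le> e t" for t unfolding e_def using R(1) by simp
    show "summable e" unfolding e_def by (rule summable_mult[OF A2_square_summable])
  qed (fact sub Y_drift)+

  then have "AE \<omega> in M. limsup (\<lambda>t. ereal (\<bar>f (weighted_average \<alpha> (\<lambda>j. x j \<omega>) t) - (INF y\<in>X. f y)\<bar>
      / (1 / (\<Sum>j=1..t. \<alpha> j)))) < \<infinity>"
    using AE_space
  proof eventually_elim
    case (elim \<omega>)
    let ?z = "weighted_average \<alpha> (\<lambda>j. x j \<omega>)"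
    have x_X': "x j \<omega> \<in> X" if "j \<ge> 1" for j
      using x_X[OF elim(2), of "j - 1"] that by simp
    \<comment> \<open>At \<open>t = 0\<close> the average is the zero vector, which need not lie in \<open>X\<close>.\<close>
    have bound: "\<bar>f (?z t) - f p\<bar> / (1 / (\<Sum>j=1..t. \<alpha> j)) \<le> (\<Sum>t. h t \<omega>)" if t: "t \<ge> 1" for t
    proof -
      note avg = weighted_average_mem_and_le[of X f \<alpha> "\<lambda>j. x j \<omega>" t]
      have f_X: "convex_on X f" using f(1) X(2) by (meson convex_on_subset subset_UNIV)
      have "?z t \<in> X" by (rule avg) (use f_X step_pos x_X' t in auto)
      then have "\<bar>f (?z t) - f p\<bar> / (1 / (\<Sum>j=1..t. \<alpha> j)) = (\<Sum>j=1..t. \<alpha> j) * f (?z t) - (\<Sum>j=1..t. \<alpha> j) * f p"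
        using p(2) by (simp add: algebra_simps)
      also have "\<dots> \<le> (\<Sum>j=1..t. \<alpha> j * f (x j \<omega>)) - (\<Sum>j=1..t. \<alpha> j) * f p"
        using avg(2) f_X step_pos x_X' t by simp
      also have "\<dots> = (\<Sum>j=1..t. \<alpha> j * (f (x j \<omega>) - f p))"
        by (simp add: sum_distrib_right sum_subtractf right_diff_distrib)
      also have "\<dots> = (\<Sum>j<t. h j \<omega>)"
        unfolding h_def by (rule sum.reindex_bij_witness[of _ Suc "\<lambda>j. j - 1"]) auto
      also have "\<dots> \<le> (\<Sum>t. h t \<omega>)"
        using pos p(2) x_X[OF elim(2)] by (intro sum_le_suminf elim) (auto simp: h_def less_imp_le)
      finally show ?thesis .
    qed
    have "limsup (\<lambda>t. ereal (\<bar>f (?z t) - f p\<bar> / (1 / (\<Sum>j=1..t. \<alpha> j)))) \<le> ereal (\<Sum>t. h t \<omega>)"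
      by (rule Limsup_bounded) (use bound in \<open>auto intro!: eventually_sequentiallyI[of 1]\<close>)
    then show ?case unfolding INF_f by (rule order_le_less_trans) simp
  qed
  then show ?thesis unfolding bigo_as_def .
qed

end
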